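(* Let $(X,R)$ be a forcing network and let $G$ be an $X$-colored graph with $n$ vertices. Then the multi-color forcing process with propagation, applying $(X,R)$ to $G$, terminates after at most $n-1$ propagating forcing steps (counting only propagating forcing steps in which at least one vertex changes color).
   Context: Let $X\subseteq\{1,\dots,N\}$ be a finite set of colors. An $X$-colored graph is a finite simple graph $G$ together with an assignment of a color from $X$ to each vertex. A forcing network is a pair $(X,R)$ where $R=(r_1,\dots,r_m)$ is an ordered list of color change rules, each of the form $a\to b$ with $a,b\in X$, $a\neq b$. A forcing step with rule $a\to b$ means: simultaneously recolor with color $a$ every vertex of color $b$ that has at least one neighbor of color $a$ (a vertex may force even if it has several neighbors of color $b$). A propagating forcing step with rule $a\to b$ means performing forcing steps with this rule repeatedly until no vertex of color $b$ has a neighbor of color $a$ (so newly recolored vertices may force further within the same propagating step). In the multi-color forcing process with propagation, the rules are applied as propagating forcing steps in the cyclic order $r_1,\dots,r_m,r_1,\dots,r_m,\dots$; the process terminates when no rule $a\to b\in R$ can be applied, i.e. no edge of $G$ joins a vertex of color $a$ to a vertex of color $b$ for any $a\to b\in R$. *)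

theory Defs
  imports "HOL-Library.While_Combinator" "Graph_Theory.Digraph"
begin

text \<open>
  Finite simple graphs are those of the locale \<^locale>\<open>graph\<close>: finite loopless digraphs without
  multiple arcs in which each edge is represented by its two opposite arcs.  Colors are natural
  numbers, and the pair \<open>(a, b)\<close> stands for the color change rule \<open>a \<rightarrow> b\<close>.
\<close>

type_synonym rule = "nat \<times> nat"

definition forcing_network :: "nat \<Rightarrow> nat set \<Rightarrow> rule list \<Rightarrow> bool" where
  "forcing_network N X R \<longleftrightarrow> X \<subseteq> {1..N} \<and> (\<forall>(a, b) \<in> set R. a \<in> X \<and> b \<in> X \<and> a \<noteq> b)"

definition colored_graph :: "nat set \<Rightarrow> ('v, 'e) pre_digraph \<Rightarrow> ('v \<Rightarrow> nat) \<Rightarrow> bool" where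
  "colored_graph X G c \<longleftrightarrow> graph G \<and> (\<forall>v \<in> verts G. c v \<in> X)"

definition applicable :: "('v, 'e) pre_digraph \<Rightarrow> rule \<Rightarrow> ('v \<Rightarrow> nat) \<Rightarrow> bool" where
  "applicable G r c \<longleftrightarrow> (case r of (a, b) \<Rightarrow> \<exists>u v. u \<rightarrow>\<^bsub>G\<^esub> v \<and> c u = a \<and> c v = b)"

definition forcing_step :: "('v, 'e) pre_digraph \<Rightarrow> rule \<Rightarrow> ('v \<Rightarrow> nat) \<Rightarrow> ('v \<Rightarrow> nat)" where
  "forcing_step G r c = (case r of (a, b) \<Rightarrow>
     (\<lambda>v. if c v = b \<and> (\<exists>u. u \<rightarrow>\<^bsub>G\<^esub> v \<and> c u = a) then a else c v))"

text \<open>The value of \<^const>\<open>while\<close> is unspecified for a loop that does not terminate.\<close>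

definition propagating_step :: "('v, 'e) pre_digraph \<Rightarrow> rule \<Rightarrow> ('v \<Rightarrow> nat) \<Rightarrow> ('v \<Rightarrow> nat)" where
  "propagating_step G r c = while (applicable G r) (forcing_step G r) c"

text \<open>
  \<open>process G R c t\<close> is the coloring after the first \<open>t\<close> propagating steps, the rules being taken
  in cyclic order from the beginning of \<open>R\<close>; steps without effect are included in \<open>t\<close>.
  For empty \<open>R\<close> only time \<open>0\<close> is meaningful: the process is then terminated at the outset.
\<close>

fun process :: "('v, 'e) pre_digraph \<Rightarrow> rule list \<Rightarrow> ('v \<Rightarrow> nat) \<Rightarrow> nat \<Rightarrow> ('v \<Rightarrow> nat)" where
  "process G R c 0 = c"
| "process G R c (Suc t) = propagating_step G (R ! (t mod length R)) (process G R c t)"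

definition terminated :: "('v, 'e) pre_digraph \<Rightarrow> rule list \<Rightarrow> ('v \<Rightarrow> nat) \<Rightarrow> bool" where
  "terminated G R c \<longleftrightarrow> (\<forall>r \<in> set R. \<not> applicable G r c)"

definition terminates_at :: "('v, 'e) pre_digraph \<Rightarrow> rule list \<Rightarrow> ('v \<Rightarrow> nat) \<Rightarrow> nat \<Rightarrow> bool" where
  "terminates_at G R c T \<longleftrightarrow>
     terminated G R (process G R c T) \<and> (\<forall>t < T. \<not> terminated G R (process G R c t))"

definition effective_steps :: "('v, 'e) pre_digraph \<Rightarrow> rule list \<Rightarrow> ('v \<Rightarrow> nat) \<Rightarrow> nat \<Rightarrow> nat set" where
  "effective_steps G R c T =
     {t. t < T \<and> (\<exists>v \<in> verts G. process G R c (Suc t) v \<noteq> process G R c t v)}"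

end

theory Submission
  imports Defs
begin

text \<open>
  The potential is the number of monochromatic components.  A propagating step of \<open>a \<rightarrow> b\<close>
  recolors a component of color \<open>b\<close> either entirely or not at all, so components never split;
  an effective step merges a component of color \<open>b\<close> with an adjacent one of color \<open>a\<close>, so their
  number drops.  It is at most \<open>n\<close> initially and at least \<open>1\<close> throughout.
\<close>

lemma card_quotient_le:
  assumes "finite A"
  shows "card (A // r) \<le> card A"
proof -
  have "A // r = (\<lambda>x. r `` {x}) ` A"
    by (auto simp: quotient_def)
  then show ?thesis
    using assms by (simp add: card_image_le)
qed

text \<open>Saturating with \<open>s\<close> maps the \<open>r\<close>-classes onto the
  \<open>s\<close>-classes. A pair in \<open>s\<close> but not in \<open>r\<close> yields two
  distinct \<open>r\<close>-classes with the same image, so between finite sets the map loses at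
  least one class.\<close>

lemma card_quotient_less:
  assumes "finite (A // r)" and sub: "r \<subset> s" and r: "equiv A r" and s: "equiv A s"
  shows "card (A // s) < card (A // r)"
proof -
  let ?f = "\<lambda>X. s `` X"
  have image: "?f ` (A // r) = A // s"
    using sub r s by (intro refines_equiv_image_eq) auto
  obtain x y where xy: "(x, y) \<in> s" "(x, y) \<notin> r"
    using sub by auto
  have A: "x \<in> A" "y \<in> A"
    using xy s by (auto simp: equiv_class_eq_iff)
  have "?f (r `` {z}) = s `` {z}" for z
    using sub r s by (intro refines_equiv_class_eq2) auto
  moreover have "s `` {x} = s `` {y}"
    using s xy(1) by (rule equiv_class_eq)
  moreover have "r `` {x} \<noteq> r `` {y}"
    using r A xy by (simp add: eq_equiv_class_iff)
  moreover have "r `` {x} \<in> A // r" "r `` {y} \<in> A // r"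
    using A by (auto intro: quotientI)
  ultimately have "\<not> inj_on ?f (A // r)"
    by (metis inj_onD)
  then have "card (?f ` (A // r)) \<noteq> card (A // r)"
    using assms(1) by (metis eq_card_imp_inj_on)
  moreover have "card (?f ` (A // r)) \<le> card (A // r)"
    using assms(1) by (rule card_image_le)
  ultimately show ?thesis
    unfolding image by simp
qed

definition monochromatic_arcs :: "('v, 'e) pre_digraph \<Rightarrow> ('v \<Rightarrow> nat) \<Rightarrow> 'v rel" where
  "monochromatic_arcs G c = {(u, v). u \<rightarrow>\<^bsub>G\<^esub> v \<and> c u = c v}"

text \<open>The reflexive-transitive closure is reflexive on the whole type; cutting it down to
  \<open>verts G\<close> makes it an equivalence there, whose classes are the monochromatic
  components.\<close>

definition monochromatic_rel :: "('v, 'e) pre_digraph \<Rightarrow> ('v \<Rightarrow> nat) \<Rightarrow> 'v rel" where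
  "monochromatic_rel G c = (monochromatic_arcs G c)\<^sup>* \<inter> verts G \<times> verts G"

definition monochromatic_components :: "('v, 'e) pre_digraph \<Rightarrow> ('v \<Rightarrow> nat) \<Rightarrow> 'v set set" where
  "monochromatic_components G c = verts G // monochromatic_rel G c"

lemma monochromatic_rel_same_color:
  assumes "(u, v) \<in> monochromatic_rel G c"
  shows "c u = c v"
proof -
  have "(u, v) \<in> (monochromatic_arcs G c)\<^sup>*"
    using assms by (simp add: monochromatic_rel_def)
  then show ?thesis
    by (induction rule: rtrancl_induct) (auto simp: monochromatic_arcs_def)
qed

lemma propagating_step_not_applicable:
  "\<not> applicable G r c \<Longrightarrow> propagating_step G r c = c"
  unfolding propagating_step_def by (subst while_unfold) simp

context graph
begin

lemma equiv_monochromatic_rel: "equiv (verts G) (monochromatic_rel G c)"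
proof (rule equivI)
  show "monochromatic_rel G c \<subseteq> verts G \<times> verts G"
    by (auto simp: monochromatic_rel_def)
  show "refl_on (verts G) (monochromatic_rel G c)"
    by (auto simp: refl_on_def monochromatic_rel_def)
  have "sym (monochromatic_arcs G c)"
    using arcs_ends_symmetric[OF sym_arcs] by (auto simp: monochromatic_arcs_def sym_def)
  then show "sym (monochromatic_rel G c)"
    unfolding monochromatic_rel_def by (intro sym_Int sym_rtrancl) (auto simp: sym_def)
  show "trans (monochromatic_rel G c)"
    unfolding monochromatic_rel_def by (intro trans_Int trans_rtrancl) (auto simp: trans_def)
qed

lemma finite_monochromatic_components: "finite (monochromatic_components G c)"
  unfolding monochromatic_components_def quotient_def by simp

text \<open>Each iteration recolors at least one vertex of color \<open>b\<close> and creates none,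
  so the number of such vertices is a termination measure and \<open>while\<close> has its intended
  value. All that later arguments use of the loop is its exit condition and the invariant that
  changes since \<open>c\<close> go from \<open>b\<close> to \<open>a\<close>.\<close>

lemma propagating_step_spec:
  fixes c :: "'a \<Rightarrow> nat"
  assumes "a \<noteq> b"
  defines "c' \<equiv> propagating_step G (a, b) c"
  shows "\<not> applicable G (a, b) c' \<and> (\<forall>v. c' v \<noteq> c v \<longrightarrow> c v = b \<and> c' v = a)"
proof -
  let ?P = "\<lambda>d. \<forall>v. d v \<noteq> c v \<longrightarrow> c v = b \<and> d v = a"
  let ?B = "\<lambda>d. {v \<in> verts G. d v = b}"
  show ?thesis
    unfolding c'_def propagating_step_def
  proof (rule while_rule[where P = ?P and r = "measure (\<lambda>d. card (?B d))"])
    fix d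
    assume P: "?P d"
    have "forcing_step G (a, b) d v = d v \<or> d v = b \<and> forcing_step G (a, b) d v = a" for v
      by (simp add: forcing_step_def)
    then show "?P (forcing_step G (a, b) d)"
      using P by (smt (verit))
    assume "applicable G (a, b) d"
    then obtain u v where uv: "u \<rightarrow>\<^bsub>G\<^esub> v" "d u = a" "d v = b"
      by (auto simp: applicable_def)
    have "v \<in> ?B d - ?B (forcing_step G (a, b) d)"
      using uv assms(1) by (auto simp: forcing_step_def adj_in_verts)
    moreover have "?B (forcing_step G (a, b) d) \<subseteq> ?B d"
      using assms(1) by (auto simp: forcing_step_def split: if_splits)
    ultimately have "?B (forcing_step G (a, b) d) \<subset> ?B d"
      by blast
    then show "(forcing_step G (a, b) d, d) \<in> measure (\<lambda>d. card (?B d))"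
      by (simp add: psubset_card_mono)
  qed auto
qed

lemma monochromatic_rel_propagating_step:
  fixes c :: "'a \<Rightarrow> nat"
  assumes ne: "a \<noteq> b" and app: "applicable G (a, b) c"
  shows "monochromatic_rel G c \<subset> monochromatic_rel G (propagating_step G (a, b) c)"
proof -
  define c' where "c' = propagating_step G (a, b) c"
  have stop: "\<not> applicable G (a, b) c'" and ch: "\<And>v. c' v \<noteq> c v \<Longrightarrow> c v = b \<and> c' v = a"
    using propagating_step_spec[OF ne, of c] by (auto simp: c'_def)
  have nadj: "\<not> (c' x = a \<and> c' y = b)" if "x \<rightarrow>\<^bsub>G\<^esub> y" for x y
    using stop that by (auto simp: applicable_def)
  have "monochromatic_arcs G c \<subseteq> monochromatic_arcs G c'"
  proof (clarsimp simp: monochromatic_arcs_def)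
    fix u v
    assume uv: "u \<rightarrow>\<^bsub>G\<^esub> v" and eq: "c u = c v"
    \<comment> \<open>If only one end of the arc changed, its ends would now be colored
      \<open>a\<close> and \<open>b\<close>, contradicting \<open>stop\<close>. Either end may be
      the changed one, so both orientations are required.\<close>
    have "v \<rightarrow>\<^bsub>G\<^esub> u"
      using sym_arcs uv by (rule arcs_ends_symmetric)
    then show "c' u = c' v"
      using nadj[OF uv] nadj[of v u] ch[of u] ch[of v] eq by metis
  qed
  then have sub: "monochromatic_rel G c \<subseteq> monochromatic_rel G c'"
    unfolding monochromatic_rel_def using rtrancl_mono by blast
  obtain u v where uv: "u \<rightarrow>\<^bsub>G\<^esub> v" "c u = a" "c v = b"
    using app by (auto simp: applicable_def)
  \<comment> \<open>\<open>u\<close> keeps color \<open>a\<close>, since only vertices of color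
    \<open>b\<close> change; then \<open>v\<close> cannot still have color \<open>b\<close>, so it
    has become \<open>a\<close>.\<close>
  have "c' u = c' v"
    using nadj[OF uv(1)] ch[of u] ch[of v] uv ne by metis
  then have "(u, v) \<in> monochromatic_rel G c'"
    using uv by (auto simp: monochromatic_rel_def monochromatic_arcs_def adj_in_verts)
  moreover have "(u, v) \<notin> monochromatic_rel G c"
    using monochromatic_rel_same_color[of u v G c] uv ne by auto
  ultimately show ?thesis
    using sub unfolding c'_def by blast
qed

lemma card_components_propagating_step:
  fixes c :: "'a \<Rightarrow> nat"
  assumes "a \<noteq> b" and "applicable G (a, b) c"
  shows "card (monochromatic_components G (propagating_step G (a, b) c))
    < card (monochromatic_components G c)"
  unfolding monochromatic_components_def
  using finite_monochromatic_components[of c] monochromatic_rel_propagating_step[OF assms]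
  by (intro card_quotient_less equiv_monochromatic_rel)
    (simp_all add: monochromatic_components_def)

lemma card_components_process_Suc:
  assumes rules: "\<forall>(a, b) \<in> set R. a \<noteq> b" and "R \<noteq> []"
    and "applicable G (R ! (t mod length R)) (process G R c t)"
  shows "card (monochromatic_components G (process G R c (Suc t)))
    < card (monochromatic_components G (process G R c t))"
proof -
  obtain a b where ab: "R ! (t mod length R) = (a, b)"
    by fastforce
  have "R ! (t mod length R) \<in> set R"
    using \<open>R \<noteq> []\<close> by (intro nth_mem) simp
  then have "a \<noteq> b"
    using rules ab by auto
  then show ?thesis
    using card_components_propagating_step assms(3) by (simp add: ab)
qed

text \<open>Amortized count: every effective step is paid for by the loss of a component, and
  initially there are at most as many components as vertices.\<close>

lemma card_effective_steps:
  assumes rules: "\<forall>(a, b) \<in> set R. a \<noteq> b" and "R \<noteq> []"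
  shows "card (effective_steps G R c T) + card (monochromatic_components G (process G R c T))
    \<le> card (verts G)"
proof (induction T)
  case 0
  then show ?case
    by (simp add: effective_steps_def monochromatic_components_def card_quotient_le)
next
  case (Suc T)
  let ?E = "effective_steps G R c"
  have fin: "finite (?E T)"
    by (simp add: effective_steps_def)
  show ?case
  proof (cases "applicable G (R ! (T mod length R)) (process G R c T)")
    case True
    \<comment> \<open>The drop in components pays for \<open>T\<close>, so an upper bound on the new
      set of steps suffices.\<close>
    have "?E (Suc T) \<subseteq> insert T (?E T)"
      by (auto simp: effective_steps_def less_Suc_eq)
    then have "card (?E (Suc T)) \<le> card (insert T (?E T))"
      using fin by (intro card_mono) auto
    also have "\<dots> \<le> Suc (card (?E T))"
      using fin by (simp add: card_insert_if)
    finally show ?thesis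
      using Suc card_components_process_Suc[OF assms True] by linarith
  next
    case False
    then have "process G R c (Suc T) = process G R c T"
      by (simp add: propagating_step_not_applicable)
    moreover from this have "?E (Suc T) = ?E T"
      by (auto simp: effective_steps_def less_Suc_eq simp del: process.simps)
    ultimately show ?thesis
      using Suc by (simp del: process.simps)
  qed
qed

text \<open>At a time \<open>t\<close> where the component count is minimal over the whole process,
  an applicable rule would push the count below the minimum. Hence the coloring is frozen from
  \<open>t\<close> on, and the cyclic order tries every rule on this same coloring.\<close>

lemma ex_terminated:
  assumes rules: "\<forall>(a, b) \<in> set R. a \<noteq> b"
  shows "\<exists>t. terminated G R (process G R c t)"
proof (cases "R = []")
  case True
  then show ?thesis
    by (simp add: terminated_def)
next
  case False
  let ?m = "\<lambda>t. card (monochromatic_components G (process G R c t))"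
  obtain t where least: "\<And>s. ?m t \<le> ?m s"
    using ex_has_least_nat[of "\<lambda>_. True" 0 ?m] by auto
  have not_app: "\<not> applicable G (R ! (s mod length R)) (process G R c t)"
    if "process G R c s = process G R c t" for s
    using card_components_process_Suc[OF rules False, of s c] least[of "Suc s"] that
    by (simp del: process.simps) (metis linorder_not_less)
  have const: "process G R c s = process G R c t" if "t \<le> s" for s
    using that
  proof (induction s rule: dec_induct)
    case (step s)
    then show ?case
      using not_app[of s] by (simp add: propagating_step_not_applicable)
  qed simp
  have "\<not> applicable G r (process G R c t)" if r: "r \<in> set R" for r
  proof -
    obtain i where i: "i < length R" "R ! i = r"
      using r by (auto simp: in_set_conv_nth)
    \<comment> \<open>A time not before \<open>t\<close>, as \<open>length R\<close> is positive,
      and congruent to \<open>i\<close> modulo \<open>length R\<close>, so that the rule tried there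
      is \<open>r\<close>.\<close>
    let ?s = "t * length R + i"
    have "t \<le> t * length R"
      using False by (simp add: Suc_le_eq)
    then have "process G R c ?s = process G R c t"
      by (intro const) linarith
    then show ?thesis
      using not_app[of ?s] i by simp
  qed
  then show ?thesis
    unfolding terminated_def by blast
qed

end

theorem theorem3p2:
  fixes N n :: nat and X :: "nat set" and R :: "(nat \<times> nat) list"
    and G :: "('v, 'e) pre_digraph" and c :: "'v \<Rightarrow> nat"
  assumes "forcing_network N X R"
    and "colored_graph X G c"
    and "card (verts G) = n"
  shows "\<exists>T. terminates_at G R c T \<and> card (effective_steps G R c T) \<le> n - 1"
proof -
  interpret graph G
    using assms(2) by (simp add: colored_graph_def)
  have rules: "\<forall>(a, b) \<in> set R. a \<noteq> b"
    using assms(1) by (auto simp: forcing_network_def)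
  define T where "T = (LEAST t. terminated G R (process G R c t))"
  have T: "terminates_at G R c T"
    unfolding terminates_at_def T_def
    using ex_terminated[OF rules] by (auto intro: LeastI_ex dest: not_less_Least)
  have "card (effective_steps G R c T) \<le> n - 1"
  \<comment> \<open>In the degenerate cases no step is effective: \<open>T = 0\<close>, or there is
    no vertex to change color, where \<open>n - 1\<close> is truncated to \<open>0\<close>.
    Otherwise at least one component survives at time \<open>T\<close>, which accounts for the
    \<open>- 1\<close>.\<close>
  proof (cases "R = [] \<or> verts G = {}")
    case True
    have "T = 0" if "R = []"
      using T that by (auto simp: terminates_at_def terminated_def)
    then show ?thesis
      using True by (auto simp: effective_steps_def)
  next
    case False
    then have "monochromatic_components G (process G R c T) \<noteq> {}"
      by (simp add: monochromatic_components_def quotient_def)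
    then have "card (monochromatic_components G (process G R c T)) > 0"
      using finite_monochromatic_components by (simp add: card_gt_0_iff)
    then show ?thesis
      using card_effective_steps[OF rules, of c T] False assms(3) by linarith
  qed
  then show ?thesis
    using T by blast
qed

end
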